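(* Let $a\ge 0$ and let $y_1,y_2\in\mathbb{R}$ with $y_1\ge y_2$. Define $f:(0,1)\to\mathbb{R}$ by $$f(\lambda)=y_2-y_1-a+2a\lambda-\log(1-\lambda)+\log(\lambda),$$ and let $\lambda^*\in(0,1)$ be the root of $f$. Set $\lambda_0=\frac{1}{1+\exp(y_2-y_1)}$. Then Newton's method $$\lambda_{k+1}=\lambda_k-\frac{f(\lambda_k)}{f'(\lambda_k)},\qquad k\ge 0,$$ converges to $\lambda^*$, with a locally quadratic rate.
   Context: The function $f$ is strictly increasing on $(0,1)$, with $f'(\lambda)=2a+\frac{1}{1-\lambda}+\frac1\lambda$, and has exactly one root there. "Converges with a locally quadratic rate" means that $\lambda_k\to\lambda^*$ and there exist a constant $C>0$ and an index $k_0$ such that $|\lambda_{k+1}-\lambda^*|\le C|\lambda_k-\lambda^*|^2$ for all $k\ge k_0$. *)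

theory Defs
  imports "HOL-Analysis.Analysis"
begin

(* Only the values for l in {0<..<1} are meaningful: outside this interval one of the
   logarithms is applied to a nonpositive argument. *)
definition newton_f :: "real \<Rightarrow> real \<Rightarrow> real \<Rightarrow> real \<Rightarrow> real" where
  "newton_f a y1 y2 l = y2 - y1 - a + 2 * a * l - ln (1 - l) + ln l"

definition converges_locally_quadratically :: "(nat \<Rightarrow> real) \<Rightarrow> real \<Rightarrow> bool" where
  "converges_locally_quadratically x l \<longleftrightarrow>
     x \<longlonglongrightarrow> l \<and>
     (\<exists>C>0. \<exists>k0. \<forall>k\<ge>k0. \<bar>x (Suc k) - l\<bar> \<le> C * \<bar>x k - l\<bar>\<^sup>2)"

end

theory Submission
  imports Defs
begin

text \<open>
  The function is convex on \<open>[1/2, 1)\<close>. Since \<open>f (1/2) = y2 - y1 \<le> 0\<close>, the root lies in this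
  interval, and since the logarithms contribute exactly \<open>y1 - y2\<close> at the starting point,
  \<open>f (lam 0) = a * (2 * lam 0 - 1) \<ge> 0\<close>, so the iteration starts to the right of the root. For a
  convex increasing function Newton's method then decreases monotonically to the root.
\<close>

text \<open>Convexity enters as monotonicity of \<open>f'\<close>. By the mean value theorem one
  step multiplies the error by \<open>(f' u - f' z) / f' u\<close> with
  \<open>r \<le> z \<le> u\<close>. Monotonicity keeps this factor in \<open>[0, q]\<close> with
  \<open>q < 1\<close>, which gives monotone geometric convergence; the Lipschitz bound makes the
  factor itself at most a multiple of the error, which gives the quadratic rate.\<close>

lemma newton_convex_converges:
  fixes f f' :: "real \<Rightarrow> real" and x :: "nat \<Rightarrow> real"
  assumes der: "\<And>u. u \<in> {r..b} \<Longrightarrow> (f has_real_derivative f' u) (at u)"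
    and mono: "\<And>u v. r \<le> u \<Longrightarrow> u \<le> v \<Longrightarrow> v \<le> b \<Longrightarrow> f' u \<le> f' v"
    and lipschitz: "\<And>u v. r \<le> u \<Longrightarrow> u \<le> v \<Longrightarrow> v \<le> b \<Longrightarrow> f' v - f' u \<le> L * (v - u)"
    and "L \<ge> 0" and pos: "f' r > 0" and root: "f r = 0"
    and start: "x 0 \<in> {r..b}"
    and step: "\<And>k. x k \<in> {r..b} \<Longrightarrow> x (Suc k) = x k - f (x k) / f' (x k)"
  shows "(\<forall>k. x k \<in> {r..b}) \<and> converges_locally_quadratically x r"
proof -
  \<comment> \<open>Upper bound for \<open>1 - f' z / f' u\<close> over
    \<open>r \<le> z \<le> u \<le> b\<close>: the slope is smallest at \<open>r\<close> and largest
    at \<open>b\<close>.\<close>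
  define q where "q = 1 - f' r / f' b"
  have "r \<le> b" using start by auto
  then have fb: "f' r \<le> f' b" using mono[of r b] by simp
  then have q: "0 \<le> q" "q < 1" using pos by (auto simp: q_def field_simps)
  \<comment> \<open>With \<open>f u = f' z * (u - r)\<close> the new error is \<open>(u - r) * (f' u - f' z) / f' u\<close>.\<close>
  have newton: "r \<le> u - f u / f' u \<and> u - f u / f' u - r \<le> q * (u - r)
      \<and> u - f u / f' u - r \<le> L / f' r * (u - r)\<^sup>2"
    if u: "u \<in> {r..b}" for u
  proof -
    obtain z where z: "r \<le> z" "z \<le> u" "f u = (u - r) * f' z"
    \<comment> \<open>The mean value theorem needs a nondegenerate interval; for
      \<open>u = r\<close> both sides vanish and \<open>z = r\<close> serves.\<close>
    proof (cases "u = r")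
      case True
      then show ?thesis using that[of r] root by simp
    next
      case False
      then have "r < u" using u by auto
      moreover have "(f has_real_derivative f' y) (at y)" if "r \<le> y" "y \<le> u" for y
        using der that u by auto
      ultimately obtain z where "r < z" "z < u" "f u - f r = (u - r) * f' z"
        using MVT2[of r u f f'] by blast
      then show ?thesis using that[of z] root by simp
    qed
    have m: "f' r \<le> f' z" "f' z \<le> f' u" "f' u \<le> f' b" using mono z u by auto
    have e: "u - f u / f' u - r = (u - r) * ((f' u - f' z) / f' u)"
      using m pos z by (simp add: field_simps)
    have "(f' u - f' z) / f' u \<ge> 0" using m pos by simp
    moreover have "(f' u - f' z) / f' u \<le> q"
    proof -
      have "f' r / f' b \<le> f' z / f' u" using m pos by (intro frac_le) auto
      then show ?thesis using m pos by (simp add: q_def diff_divide_distrib)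
    qed
    moreover have "(f' u - f' z) / f' u \<le> L / f' r * (u - r)"
    proof -
      have "f' u - f' z \<le> L * (u - z)" using lipschitz z u by auto
      also have "\<dots> \<le> L * (u - r)" using z \<open>L \<ge> 0\<close> by (intro mult_left_mono) auto
      finally have "(f' u - f' z) / f' u \<le> L * (u - r) / f' r"
        using m pos u \<open>L \<ge> 0\<close> by (intro frac_le) auto
      then show ?thesis by simp
    qed
    ultimately have "0 \<le> (u - r) * ((f' u - f' z) / f' u)"
      "(u - r) * ((f' u - f' z) / f' u) \<le> (u - r) * q"
      "(u - r) * ((f' u - f' z) / f' u) \<le> (u - r) * (L / f' r * (u - r))"
      using u by (auto intro!: mult_nonneg_nonneg mult_left_mono simp del: times_divide_eq_left
          times_divide_eq_right)
    moreover have "(u - r) * (L / f' r * (u - r)) = L / f' r * (u - r)\<^sup>2"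
      by (simp add: power2_eq_square)
    ultimately show ?thesis using e mult.commute[of "u - r" q] by linarith
  qed
  have range: "x k \<in> {r..b}" for k
  proof (induction k)
    case (Suc k)
    have "q * (x k - r) \<le> 1 * (x k - r)" using Suc q by (intro mult_right_mono) auto
    then show ?case using newton[OF Suc] step[OF Suc] Suc by auto
  qed (fact start)
  have geometric: "x k - r \<le> q ^ k * (x 0 - r)" for k
  proof (induction k)
    case (Suc k)
    have "x (Suc k) - r \<le> q * (x k - r)" using newton[OF range] step[OF range] by simp
    also have "\<dots> \<le> q * (q ^ k * (x 0 - r))" using Suc q by (intro mult_left_mono)
    finally show ?case by simp
  qed simp
  have "(\<lambda>k. q ^ k * (x 0 - r)) \<longlonglongrightarrow> 0 * (x 0 - r)"
    using q by (intro tendsto_mult LIMSEQ_power_zero tendsto_const) auto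
  then have "(\<lambda>k. q ^ k * (x 0 - r)) \<longlonglongrightarrow> 0" by simp
  then have "(\<lambda>k. x k - r) \<longlonglongrightarrow> 0"
    by (rule real_tendsto_sandwich[rotated 3, where f = "\<lambda>_. 0"])
      (use range geometric in \<open>auto intro!: always_eventually\<close>)
  then have lim: "x \<longlonglongrightarrow> r" by (rule LIM_zero_cancel)
  \<comment> \<open>The added 1 keeps the constant strictly positive even when
    \<open>L = 0\<close>.\<close>
  have "\<bar>x (Suc k) - r\<bar> \<le> (L / f' r + 1) * \<bar>x k - r\<bar>\<^sup>2" for k
  proof -
    have "\<bar>x (Suc k) - r\<bar> \<le> L / f' r * (x k - r)\<^sup>2"
      using newton[OF range[of k]] step[OF range[of k]] by simp
    also have "\<dots> \<le> (L / f' r + 1) * (x k - r)\<^sup>2" by (intro mult_right_mono) auto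
    finally show ?thesis by simp
  qed
  moreover have "L / f' r + 1 > 0" using pos \<open>L \<ge> 0\<close> by (simp add: add_nonneg_pos)
  ultimately show ?thesis using range lim unfolding converges_locally_quadratically_def by blast
qed

definition newton_f' :: "real \<Rightarrow> real \<Rightarrow> real" where
  "newton_f' a l = 2 * a + 1 / (1 - l) + 1 / l"

lemma newton_f_has_derivative:
  assumes "l \<in> {0<..<1}"
  shows "(newton_f a y1 y2 has_real_derivative newton_f' a l) (at l)"
  unfolding newton_f_def[abs_def] newton_f'_def
  using assms by (auto intro!: derivative_eq_intros simp: field_simps)

lemma newton_f'_pos:
  assumes "a \<ge> 0" "l \<in> {0<..<1}"
  shows "newton_f' a l > 0"
  using assms by (auto simp: newton_f'_def intro!: add_nonneg_pos)

lemma newton_f_strict_mono: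
  assumes "a \<ge> 0" "u \<in> {0<..<1}" "v \<in> {0<..<1}" "u < v"
  shows "newton_f a y1 y2 u < newton_f a y1 y2 v"
proof (rule DERIV_pos_imp_increasing[OF \<open>u < v\<close>])
  fix x assume "u \<le> x" "x \<le> v"
  then have "x \<in> {0<..<1}" using assms by auto
  then show "\<exists>y. (newton_f a y1 y2 has_real_derivative y) (at x) \<and> y > 0"
    using newton_f_has_derivative newton_f'_pos assms by blast
qed

text \<open>Factoring out \<open>v - u\<close> leaves a difference of two positive terms: comparing
  them gives monotonicity, and dropping the second gives a Lipschitz bound.\<close>

lemma newton_f'_diff:
  assumes "u \<in> {0<..<1}" "v \<in> {0<..<1}"
  shows "newton_f' a v - newton_f' a u = (v - u) * (1 / ((1 - u) * (1 - v)) - 1 / (u * v))"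
proof -
  have "1 / (1 - v) - 1 / (1 - u) = (v - u) * (1 / ((1 - u) * (1 - v)))"
    using assms by (simp add: divide_simps)
  moreover have "1 / v - 1 / u = - ((v - u) * (1 / (u * v)))"
    using assms by (simp add: divide_simps)
  ultimately show ?thesis unfolding newton_f'_def right_diff_distrib by linarith
qed

lemma newton_f'_mono:
  assumes "1 / 2 \<le> u" "u \<le> v" "v < 1"
  shows "newton_f' a u \<le> newton_f' a v"
proof -
  \<comment> \<open>Expanded, this is \<open>1 \<le> u + v\<close>, the only place where
    \<open>1 / 2 \<le> u\<close> is decisive.\<close>
  have "(1 - u) * (1 - v) \<le> u * v" using assms by (simp add: algebra_simps)
  then have "1 / (u * v) \<le> 1 / ((1 - u) * (1 - v))" using assms by (intro frac_le) auto
  then have "0 \<le> newton_f' a v - newton_f' a u"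
    using assms by (subst newton_f'_diff) (auto intro!: mult_nonneg_nonneg)
  then show ?thesis by simp
qed

lemma newton_f'_lipschitz:
  assumes "0 < u" "u \<le> v" "v \<le> b" "b < 1"
  shows "newton_f' a v - newton_f' a u \<le> 1 / (1 - b)\<^sup>2 * (v - u)"
proof -
  have "1 / ((1 - u) * (1 - v)) \<le> 1 / ((1 - b) * (1 - b))"
    using assms by (intro frac_le mult_mono) auto
  moreover have "0 \<le> 1 / (u * v)" using assms by simp
  ultimately have "1 / ((1 - u) * (1 - v)) - 1 / (u * v) \<le> 1 / (1 - b)\<^sup>2"
    unfolding power2_eq_square by linarith
  then have "(v - u) * (1 / ((1 - u) * (1 - v)) - 1 / (u * v)) \<le> (v - u) * (1 / (1 - b)\<^sup>2)"
    using assms by (intro mult_left_mono) auto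
  then show ?thesis using assms by (subst newton_f'_diff) (auto simp: mult.commute)
qed

text \<open>The starting point is the logistic function at \<open>y1 - y2\<close>, so its log-odds
  cancel \<open>y2 - y1\<close> and only the terms with \<open>a\<close> survive.\<close>

lemma newton_f_start:
  "newton_f a y1 y2 (1 / (1 + exp (y2 - y1))) = a * (2 / (1 + exp (y2 - y1)) - 1)"
proof -
  let ?e = "exp (y2 - y1)"
  have e: "1 + ?e > 0" by (simp add: add_pos_pos)
  then have "1 - 1 / (1 + ?e) = ?e / (1 + ?e)" by (simp add: field_simps)
  then have "ln (1 - 1 / (1 + ?e)) = y2 - y1 - ln (1 + ?e)" using e by (simp add: ln_div)
  moreover have "ln (1 / (1 + ?e)) = - ln (1 + ?e)" using e by (simp add: ln_div)
  ultimately show ?thesis by (simp add: newton_f_def algebra_simps)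
qed

theorem proposition7:
  fixes a y1 y2 lstar :: real and lam :: "nat \<Rightarrow> real"
  assumes "a \<ge> 0" and "y1 \<ge> y2"
    and "lstar \<in> {0<..<1}" and "newton_f a y1 y2 lstar = 0"
    and "lam 0 = 1 / (1 + exp (y2 - y1))"
    and "\<And>k. lam (Suc k) =
           lam k - newton_f a y1 y2 (lam k) / deriv (newton_f a y1 y2) (lam k)"
  shows "(\<forall>k. lam k \<in> {0<..<1}) \<and> converges_locally_quadratically lam lstar"
proof -
  have lam0: "1 / 2 \<le> lam 0" "lam 0 < 1"
    using assms(2,5) by (auto simp: field_simps add_pos_pos)
  have "newton_f a y1 y2 (1 / 2) \<le> 0"
    using assms(2) by (simp add: newton_f_def)
  \<comment> \<open>A root left of \<open>1 / 2\<close> would force a positive value at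
    \<open>1 / 2\<close>; the bound by \<open>lam 0\<close> below is the mirror argument.\<close>
  then have "1 / 2 \<le> lstar"
    using newton_f_strict_mono[OF assms(1,3), of "1 / 2" y1 y2] assms(4) by force
  moreover have "newton_f a y1 y2 (lam 0) = a * (2 * lam 0 - 1)"
    using newton_f_start assms(5) by simp
  then have "newton_f a y1 y2 (lam 0) \<ge> 0"
    using lam0 assms(1) by simp
  then have "lstar \<le> lam 0"
    using newton_f_strict_mono[OF assms(1) _ assms(3), of "lam 0" y1 y2] assms(4) lam0 by force
  ultimately have in01: "u \<in> {0<..<1}" if "u \<in> {lstar..lam 0}" for u
    using that lam0 by auto
  have "(\<forall>k. lam k \<in> {lstar..lam 0}) \<and> converges_locally_quadratically lam lstar"
  \<comment> \<open>The right end \<open>lam 0\<close> stays away from the singularity at 1, so the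
    slope has a finite Lipschitz constant on the whole interval.\<close>
  proof (rule newton_convex_converges[where f = "newton_f a y1 y2" and f' = "newton_f' a"
        and L = "1 / (1 - lam 0)\<^sup>2"])
    \<comment> \<open>\<open>deriv\<close> agrees with the explicit formula once the iterate is
      known to lie in \<open>(0, 1)\<close>, hence the step rule conditional on the
      interval.\<close>
    show "lam (Suc k) = lam k - newton_f a y1 y2 (lam k) / newton_f' a (lam k)"
      if "lam k \<in> {lstar..lam 0}" for k
      using assms(6) DERIV_imp_deriv[OF newton_f_has_derivative[OF in01[OF that]]] by simp
    show "newton_f' a v - newton_f' a u \<le> 1 / (1 - lam 0)\<^sup>2 * (v - u)"
      if "lstar \<le> u" "u \<le> v" "v \<le> lam 0" for u v
      using newton_f'_lipschitz[of u v "lam 0" a] that lam0 assms(3) by simp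
  qed (use assms(1,3,4) lam0 in01 \<open>1 / 2 \<le> lstar\<close> \<open>lstar \<le> lam 0\<close> in
      \<open>auto intro: newton_f_has_derivative newton_f'_pos newton_f'_mono\<close>)
  then show ?thesis using in01 by blast
qed

end
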